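(* Assume the posterior function $\eta$ is $(\lambda,\upsilon)$-Hölder smooth. Suppose the data distribution on $\mathcal{X}\times\{0,1\}$ has an $(\alpha,\beta,\gamma)$ Boltzmann margin. Let $C_\upsilon = 2 + d/\upsilon$. If $k = O\big(n^{\frac{\beta+2}{\beta+C_\upsilon}}\big)$, then for $n \ge (C'\ln n)^{1+C_\upsilon/\beta}$ the kNN classifier $\hat y$ trained on $n$ i.i.d. points satisfies $$\|\hat y-\hat y_*\|_e \le C_\alpha \exp\left(-C_\gamma\, n^{\frac{\beta}{\beta+C_\upsilon}}\right),$$ where $C_\alpha = 2+\alpha$, $C_\gamma=\min(\gamma,1/C')$ and $C'>0$ is a constant depending on $\lambda,\upsilon$ and the structure of $\mathcal{X}$.
   Context: $\mathcal{X}$ is a data space equipped with a norm $\|\cdot\|$, and $(X,Y)$ is a random pair in $\mathcal{X}\times\{0,1\}$ (its law is the data distribution). $B(x,r)=\{x'\in\mathcal{X}:\|x-x'\|\le r\}$. The intrinsic dimension $d$ is an integer for which there is a constant $C_d>0$ with $\Pr\{X\in B(x,r)\}\ge\min(C_d r^d,1)$ for all $x\in\mathcal{X}$, $r>0$. "The structure of $\mathcal{X}$" refers to $d$ (with its constant $C_d$) and the VC dimension of the class of balls on $\mathcal{X}$. $\eta(x)=\mathbb{E}[Y\mid X=x]$ is the posterior function; it is $(\lambda,\upsilon)$-Hölder smooth ($\lambda,\upsilon>0$ constants) if $|\eta(x)-\eta(x')|\le\lambda\|x-x'\|^\upsilon$ for all $x,x'\in\mathcal{X}$. $(\alpha,\beta,\gamma)$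 Boltzmann margin ($\alpha,\beta,\gamma>0$ constants): for all $t>0$, $\Pr_X\{|1/2-\eta(X)|\le t\}\le\alpha\exp(-\gamma t^{-\beta})$. Let $S$ be an i.i.d. sample of $n$ labeled points from the data distribution. For $x\in\mathcal{X}$, $N_k(x;S)$ is the set of $k$ nearest neighbors of $x$ in $S$, $\hat\eta(x;S)=\frac1k\sum_{(x',y')\in S}\mathbb{I}\{x'\in N_k(x;S),\,y'=1\}$, and the kNN classifier is $\hat y(x)=\mathbb{I}\{\hat\eta(x;S)\ge1/2\}$. Ties (e.g. in the distance to the $k$th nearest neighbor, or in the decision rule) are assumed to occur with probability zero. The error of a classifier $h$ is $er(h)=\Pr_{X,Y}\{h(X)\ne Y\}$; the Bayes classifier is $\hat y_*(x)=\mathbb{I}\{\eta(x)\ge1/2\}$; the expected excess error is $\|\hat y-\hat y_*\|_e=\mathbb{E}_S[er(\hat y)]-er(\hat y_* )$.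
   Formalization: k = O(n^e) as a bare upper bound makes the claim false (k = 1, η ≡ 3/4); it is read as c·n^e ≤ k ≤ K·n^e, with K fixed by λ, υ and the structure of 𝒳, any 0 < c < K, and C' depending also on c. Constants are stated uniformly over all 𝒳 inside a given normed space. *)

theory Defs
  imports "HOL-Probability.Probability" "HOL-Library.Extended_Nat"
begin

text \<open>
  The data space is a subset \<open>\<X>\<close> of a real normed space, not the whole space: the intrinsic dimension
  condition below forces \<open>\<X>\<close> to be bounded, so it would be unsatisfiable on all of \<open>\<real>\<^sup>m\<close>.
  No separability is assumed of the ambient space; the same condition makes \<open>\<X>\<close> totally bounded.
\<close>

definition data_algebra :: "'a::real_normed_vector set \<Rightarrow> ('a \<times> nat) measure" where
  "data_algebra \<X> = restrict_space borel \<X> \<Otimes>\<^sub>M count_space {0, 1}"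

definition data_distribution :: "'a::real_normed_vector set \<Rightarrow> ('a \<times> nat) measure \<Rightarrow> bool" where
  "data_distribution \<X> D \<longleftrightarrow> prob_space D \<and> sets D = sets (data_algebra \<X>)"

definition data_ball :: "'a::real_normed_vector set \<Rightarrow> 'a \<Rightarrow> real \<Rightarrow> 'a set" where
  "data_ball \<X> x r = {x' \<in> \<X>. norm (x - x') \<le> r}"

definition intrinsic_dimension ::
  "'a::real_normed_vector set \<Rightarrow> ('a \<times> nat) measure \<Rightarrow> nat \<Rightarrow> real \<Rightarrow> bool" where
  "intrinsic_dimension \<X> D d C\<^sub>d \<longleftrightarrow>
     (\<forall>x\<in>\<X>. \<forall>r>0. \<P>(z in D. fst z \<in> data_ball \<X> x r) \<ge> min (C\<^sub>d * r ^ d) 1)"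

definition shatters :: "'a set set \<Rightarrow> 'a set \<Rightarrow> bool" where
  "shatters F A \<longleftrightarrow> (\<forall>B\<subseteq>A. \<exists>C\<in>F. C \<inter> A = B)"

definition vc_dim :: "'a set set \<Rightarrow> enat" where
  "vc_dim F = (SUP A \<in> {A. finite A \<and> shatters F A}. enat (card A))"

definition ball_class :: "'a::real_normed_vector set \<Rightarrow> 'a set set" where
  "ball_class \<X> = {data_ball \<X> x r | x r. x \<in> \<X> \<and> r > 0}"

text \<open>
  \<open>\<eta>\<close> is a pointwise function on \<open>\<X>\<close> with \<open>\<eta>(X) = E[Y | X]\<close> almost surely, the conditioning being on
  the \<open>\<sigma>\<close>-algebra generated by the first coordinate.
\<close>

definition posterior ::
  "'a::real_normed_vector set \<Rightarrow> ('a \<times> nat) measure \<Rightarrow> ('a \<Rightarrow> real) \<Rightarrow> bool" where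
  "posterior \<X> D \<eta> \<longleftrightarrow>
     \<eta> \<in> borel_measurable (restrict_space borel \<X>) \<and>
     (AE z in D. \<eta> (fst z) =
        real_cond_exp D (vimage_algebra (space D) fst (restrict_space borel \<X>)) (\<lambda>z. real (snd z)) z)"

definition hoelder_smooth ::
  "'a::real_normed_vector set \<Rightarrow> ('a \<Rightarrow> real) \<Rightarrow> real \<Rightarrow> real \<Rightarrow> bool" where
  "hoelder_smooth \<X> \<eta> lam ups \<longleftrightarrow>
     (\<forall>x\<in>\<X>. \<forall>x'\<in>\<X>. \<bar>\<eta> x - \<eta> x'\<bar> \<le> lam * norm (x - x') powr ups)"

definition boltzmann_margin ::
  "('a \<times> nat) measure \<Rightarrow> ('a \<Rightarrow> real) \<Rightarrow> real \<Rightarrow> real \<Rightarrow> real \<Rightarrow> bool" where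
  "boltzmann_margin D \<eta> \<alpha> \<beta> \<gamma> \<longleftrightarrow>
     (\<forall>t>0. \<P>(z in D. \<bar>1/2 - \<eta> (fst z)\<bar> \<le> t) \<le> \<alpha> * exp (- \<gamma> * t powr (- \<beta>)))"

text \<open>
  A sample of size \<open>n\<close> is a function on \<open>{..<n}\<close>, and neighbours are represented by their indices.
  Point \<open>i\<close> is among the \<open>k\<close> nearest neighbours of \<open>x\<close> if fewer than \<open>k\<close> sample points are strictly
  closer to \<open>x\<close>. For \<open>1 \<le> k \<le> n\<close> this set has at least \<open>k\<close> elements, and exactly \<open>k\<close> iff there is
  no tie across the \<open>k\<close>-th smallest distance.
\<close>

definition iid_sample :: "('a \<times> nat) measure \<Rightarrow> nat \<Rightarrow> (nat \<Rightarrow> 'a \<times> nat) measure" where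
  "iid_sample D n = (\<Pi>\<^sub>M i\<in>{..<n}. D)"

definition nearest_neighbors ::
  "nat \<Rightarrow> nat \<Rightarrow> (nat \<Rightarrow> 'a::real_normed_vector \<times> nat) \<Rightarrow> 'a \<Rightarrow> nat set" where
  "nearest_neighbors k n S x =
     {i. i < n \<and> card {j. j < n \<and> norm (x - fst (S j)) < norm (x - fst (S i))} < k}"

definition no_distance_ties :: "('a::real_normed_vector \<times> nat) measure \<Rightarrow> nat \<Rightarrow> nat \<Rightarrow> bool" where
  "no_distance_ties D k n \<longleftrightarrow>
     (AE (S, z) in iid_sample D n \<Otimes>\<^sub>M D. card (nearest_neighbors k n S (fst z)) = k)"

definition eta_hat ::
  "nat \<Rightarrow> nat \<Rightarrow> (nat \<Rightarrow> 'a::real_normed_vector \<times> nat) \<Rightarrow> 'a \<Rightarrow> real" where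
  "eta_hat k n S x =
     (1 / real k) * (\<Sum>i<n. of_bool (i \<in> nearest_neighbors k n S x \<and> snd (S i) = 1))"

definition knn_classifier ::
  "nat \<Rightarrow> nat \<Rightarrow> (nat \<Rightarrow> 'a::real_normed_vector \<times> nat) \<Rightarrow> 'a \<Rightarrow> nat" where
  "knn_classifier k n S x = of_bool (eta_hat k n S x \<ge> 1/2)"

definition bayes_classifier :: "('a \<Rightarrow> real) \<Rightarrow> 'a \<Rightarrow> nat" where
  "bayes_classifier \<eta> x = of_bool (\<eta> x \<ge> 1/2)"

definition er :: "('a \<times> nat) measure \<Rightarrow> ('a \<Rightarrow> nat) \<Rightarrow> real" where
  "er D h = \<P>(z in D. h (fst z) \<noteq> snd z)"

definition expected_excess_error ::
  "('a::real_normed_vector \<times> nat) measure \<Rightarrow> ('a \<Rightarrow> real) \<Rightarrow> nat \<Rightarrow> nat \<Rightarrow> real" where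
  "expected_excess_error D \<eta> k n =
     (LINT S|iid_sample D n. er D (knn_classifier k n S)) - er D (bayes_classifier \<eta>)"

text \<open>
  The condition \<open>k = O(n\<^sup>e)\<close> on the number of neighbours means that \<open>k\<close> is of exact order \<open>n\<^sup>e\<close> with a
  suitable implied constant: \<open>c n\<^sup>e \<le> k \<le> K n\<^sup>e\<close>, where \<open>K\<close> is determined by \<open>\<lambda>\<close>, \<open>\<upsilon>\<close> and the structure
  of \<open>\<X>\<close>, and \<open>c < K\<close> is any fixed positive number. As a bare upper bound it would admit \<open>k = 1\<close>, for
  which the excess error need not tend to zero; and an arbitrary upper constant \<open>K\<close> makes the bias too large
  for the constant \<open>\<gamma>\<close> to survive in the exponent.
\<close>

end

theory Submission
  imports Defs
begin

text \<open>
  The excess error is at most the probability that the two classifiers disagree. Put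
  \<open>t = n powr (- 1 / (\<beta> + C\<^sub>\<upsilon>))\<close>. Points with \<open>\<bar>1/2 - \<eta>\<bar> \<le> t\<close> have mass at most
  \<open>\<alpha> exp (- \<gamma> n powr (\<beta> / (\<beta> + C\<^sub>\<upsilon>)))\<close> by the margin condition. Let \<open>x\<close> be any other point and
  choose \<open>r\<close> with \<open>\<lambda> r powr \<upsilon> = t/2\<close>, so that \<open>\<eta>\<close> stays \<open>t/2\<close> away from \<open>1/2\<close> on the ball \<open>B(x,r)\<close>.
  That ball has mass at least \<open>4k/n\<close>, so by a Chernoff bound it contains all \<open>k\<close> neighbours of \<open>x\<close> except
  with probability \<open>exp (- k)\<close>; and, given that, the majority of their labels is wrong with
  probability at most \<open>exp (- k t\<^sup>2 / 4)\<close>. Here \<open>k t\<^sup>2\<close> is of order \<open>n powr (\<beta> / (\<beta> + C\<^sub>\<upsilon>))\<close>.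
\<close>

section \<open>Separated sets and nets from lower bounds on ball masses\<close>

text \<open>Balls of radius \<open>e/2\<close> around points more than \<open>e\<close> apart are
  disjoint. Each has mass at least \<open>c\<close> and the total mass is 1, so at most
  \<open>1 / c\<close> of them fit.\<close>

lemma separated_finite:
  fixes \<X> :: "'a::real_normed_vector set"
  assumes "prob_space D" "e > 0" "c > 0"
    and meas: "\<And>x. x \<in> \<X> \<Longrightarrow> {z \<in> space D. fst z \<in> data_ball \<X> x (e/2)} \<in> sets D"
    and mass: "\<And>x. x \<in> \<X> \<Longrightarrow> \<P>(z in D. fst z \<in> data_ball \<X> x (e/2)) \<ge> c"
    and Q: "finite Q" "Q \<subseteq> \<X>" "\<And>x y. x \<in> Q \<Longrightarrow> y \<in> Q \<Longrightarrow> x \<noteq> y \<Longrightarrow> norm (x - y) > e"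
  shows "real (card Q) \<le> 1 / c"
proof -
  interpret prob_space D by fact
  let ?B = "\<lambda>x. {z \<in> space D. fst z \<in> data_ball \<X> x (e/2)}"
  have disj: "disjoint_family_on ?B Q"
  proof (unfold disjoint_family_on_def, intro ballI impI)
    fix x y assume xy: "x \<in> Q" "y \<in> Q" "x \<noteq> y"
    show "?B x \<inter> ?B y = {}"
    proof (rule ccontr)
      assume "?B x \<inter> ?B y \<noteq> {}"
      then obtain z where "norm (x - fst z) \<le> e/2" "norm (y - fst z) \<le> e/2"
        by (auto simp: data_ball_def)
      moreover have "norm (x - y) \<le> norm (x - fst z) + norm (y - fst z)"
        by (metis diff_diff_eq2 norm_minus_commute norm_triangle_ineq diff_add_cancel add_diff_eq)
      ultimately show False using Q(3)[OF xy] by linarith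
    qed
  qed
  have "real (card Q) * c = (\<Sum>x\<in>Q. c)" by simp
  also have "\<dots> \<le> (\<Sum>x\<in>Q. prob (?B x))"
    using mass Q(2) by (intro sum_mono) auto
  also have "\<dots> = prob (\<Union>x\<in>Q. ?B x)"
    using meas Q(1,2) disj by (intro finite_measure_finite_Union[symmetric]) auto
  also have "\<dots> \<le> 1" by simp
  finally show ?thesis using \<open>c > 0\<close> by (simp add: field_simps)
qed

text \<open>A separated set of greatest cardinality, which exists by the uniform bound, is already a
  net: a point farther than \<open>e\<close> from all its elements could be added to it.\<close>

lemma maximal_separated_net:
  fixes \<X> :: "'a::real_normed_vector set"
  assumes bound: "\<And>Q. finite Q \<Longrightarrow> Q \<subseteq> \<X> \<Longrightarrow>
      (\<And>x y. x \<in> Q \<Longrightarrow> y \<in> Q \<Longrightarrow> x \<noteq> y \<Longrightarrow> norm (x - y) > e) \<Longrightarrow> real (card Q) \<le> M"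
    and "e > 0"
  shows "\<exists>Q. finite Q \<and> Q \<subseteq> \<X> \<and> (\<forall>x\<in>\<X>. \<exists>q\<in>Q. norm (x - q) \<le> e)"
proof -
  define P where "P Q \<longleftrightarrow> finite Q \<and> Q \<subseteq> \<X> \<and> (\<forall>x\<in>Q. \<forall>y\<in>Q. x \<noteq> y \<longrightarrow> norm (x - y) > e)" for Q
  have "P {}" by (simp add: P_def)
  moreover have "card Q \<le> nat \<lceil>M\<rceil>" if "P Q" for Q
    using bound[of Q] that unfolding P_def by (simp add: le_nat_iff le_ceiling_iff)
  ultimately obtain Q where Q: "P Q" "\<And>Q'. P Q' \<Longrightarrow> card Q' \<le> card Q"
    using ex_has_greatest_nat[of P "{}" card "Suc (nat \<lceil>M\<rceil>)"] by (metis le_imp_less_Suc)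
  have "\<exists>q\<in>Q. norm (x - q) \<le> e" if "x \<in> \<X>" for x
  proof (rule ccontr)
    assume far: "\<not> ?thesis"
    then have "x \<notin> Q" using \<open>e > 0\<close> by fastforce
    have "P (insert x Q)"
      using Q(1) far that unfolding P_def by (auto simp: norm_minus_commute not_le)
    then have "card (insert x Q) \<le> card Q" by (rule Q(2))
    then show False using \<open>x \<notin> Q\<close> Q(1) unfolding P_def by simp
  qed
  then show ?thesis using Q(1) unfolding P_def by (intro exI[of _ Q]) auto
qed

section \<open>Tools: integrating out one coordinate, tilted weights, counting\<close>

text \<open>Tonelli with coordinate \<open>i\<close> innermost: the hypothesis bounds the inner
  integral with the other coordinates frozen. This is the step by which the label weights are later
  removed one at a time.\<close>

lemma (in product_sigma_finite) nn_integral_PiM_coordinate_le: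
  assumes I: "finite I" "i \<in> I"
    and [measurable]: "g \<in> borel_measurable (Pi\<^sub>M I M)" "h \<in> borel_measurable (M i)"
    and le: "\<And>S. S \<in> space (Pi\<^sub>M (I - {i}) M) \<Longrightarrow>
      (\<integral>\<^sup>+z. g (S(i := z)) * h z \<partial>M i) \<le> q * (\<integral>\<^sup>+z. g (S(i := z)) \<partial>M i)"
  shows "(\<integral>\<^sup>+S. g S * h (S i) \<partial>Pi\<^sub>M I M) \<le> q * (\<integral>\<^sup>+S. g S \<partial>Pi\<^sub>M I M)"
proof -
  define J where "J = I - {i}"
  have J: "finite J" "i \<notin> J" "I = insert i J" using I by (auto simp: J_def)
  note [measurable] = assms(3)[unfolded J(3)]
  have i: "i \<in> insert i J" by simp
  have "(\<integral>\<^sup>+S. g S * h (S i) \<partial>Pi\<^sub>M I M)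
      = (\<integral>\<^sup>+S. (\<integral>\<^sup>+z. g (S(i := z)) * h z \<partial>M i) \<partial>Pi\<^sub>M J M)"
    unfolding J(3) using i by (subst product_nn_integral_insert[OF J(1,2)]) simp_all
  also have "\<dots> \<le> (\<integral>\<^sup>+S. q * (\<integral>\<^sup>+z. g (S(i := z)) \<partial>M i) \<partial>Pi\<^sub>M J M)"
    using le by (intro nn_integral_mono) (simp add: J_def)
  also have "\<dots> = q * (\<integral>\<^sup>+S. g S \<partial>Pi\<^sub>M I M)"
    unfolding J(3) by (subst product_nn_integral_insert[OF J(1,2)])
      (auto intro!: nn_integral_cmult sigma_finite_measure.borel_measurable_nn_integral sigma_finite_measures)
  finally show ?thesis .
qed

text \<open>
  If \<open>\<delta>\<close>-biased labels are weighted by \<open>1 - \<delta>\<close> when they agree with the bias and by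
  \<open>1 + \<delta> + 2 \<delta>\<^sup>2\<close> when they do not, a wrong majority makes the product of the weights at least 1, while
  each weight has mean at most \<open>1 - \<delta>\<^sup>2\<close>. This is the exponential tilting of Hoeffding's inequality
  with polynomial weights.
\<close>

lemma tilted_weights_power_ge_one:
  fixes \<delta> :: real
  assumes "0 \<le> \<delta>" "\<delta> \<le> 1/2" "m \<le> l"
  shows "1 \<le> (1 - \<delta>) ^ m * (1 + \<delta> + 2 * \<delta>\<^sup>2) ^ l"
proof -
  have "(1 - \<delta>) * (1 + \<delta> + 2 * \<delta>\<^sup>2) = 1 + \<delta>\<^sup>2 * (1 - 2 * \<delta>)"
    by (simp add: algebra_simps power2_eq_square)
  also have "\<dots> \<ge> 1" using assms by simp
  finally have "1 \<le> ((1 - \<delta>) * (1 + \<delta> + 2 * \<delta>\<^sup>2)) ^ m" by (rule one_le_power)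
  moreover have "1 \<le> (1 + \<delta> + 2 * \<delta>\<^sup>2) ^ (l - m)"
    using assms by (intro one_le_power) simp
  ultimately have "1 * 1 \<le> ((1 - \<delta>) * (1 + \<delta> + 2 * \<delta>\<^sup>2)) ^ m * (1 + \<delta> + 2 * \<delta>\<^sup>2) ^ (l - m)"
    by (intro mult_mono) auto
  also have "\<dots> = (1 - \<delta>) ^ m * (1 + \<delta> + 2 * \<delta>\<^sup>2) ^ (m + (l - m))"
    by (simp add: power_mult_distrib power_add)
  finally show ?thesis using assms by simp
qed

lemma tilted_weights_mean_le:
  fixes \<delta> p :: real
  assumes "0 \<le> \<delta>" "p \<le> 1/2 - \<delta>"
  shows "(1 - \<delta>) + ((1 + \<delta> + 2 * \<delta>\<^sup>2) - (1 - \<delta>)) * p \<le> 1 - \<delta>\<^sup>2"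
proof -
  have "((1 + \<delta> + 2 * \<delta>\<^sup>2) - (1 - \<delta>)) * p \<le> (2 * \<delta> + 2 * \<delta>\<^sup>2) * (1/2 - \<delta>)"
    using assms by (simp add: mult_left_mono)
  also have "\<dots> = \<delta> - \<delta>\<^sup>2 - 2 * \<delta> ^ 3"
    by (simp add: algebra_simps power2_eq_square power3_eq_cube)
  also have "\<dots> \<le> \<delta> - \<delta>\<^sup>2" using assms by simp
  finally show ?thesis by simp
qed

lemma prod_if_const:
  fixes u v :: "'b::comm_monoid_mult"
  assumes "finite I"
  shows "(\<Prod>i\<in>I. if P i then v else u) = v ^ card {i\<in>I. P i} * u ^ card {i\<in>I. \<not> P i}"
proof -
  have "I \<inter> - {i. P i} = {i\<in>I. \<not> P i}" "I \<inter> {i. P i} = {i\<in>I. P i}" by auto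
  then show ?thesis using assms by (simp add: prod.If_cases)
qed

lemma card_split: "finite I \<Longrightarrow> card {i\<in>I. P i} + card {i\<in>I. \<not> P i} = card I"
  by (subst card_Un_disjoint[symmetric]) (auto intro: arg_cong[where f = card])

text \<open>Turns the cardinality of a set that varies with the sample into a finite sum, a form in
  which its measurability can be derived.\<close>

lemma card_Collect_less_eq_sum: "card {j. j < n \<and> P j} = (\<Sum>j<(n::nat). if P j then 1 else 0)"
proof -
  have "{j. j < n \<and> P j} = {j\<in>{..<n}. P j}" by auto
  then show ?thesis by (simp add: sum.If_cases Int_def)
qed

text \<open>Registered for the events on which two classifiers, or a classifier and a label, are
  compared.\<close>

lemma pred_nat_eq [measurable (raw)]:
  fixes f g :: "'b \<Rightarrow> nat"
  assumes [measurable]: "f \<in> measurable M (count_space UNIV)" "g \<in> measurable M (count_space UNIV)"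
  shows "Measurable.pred M (\<lambda>x. f x = g x)"
proof -
  have "{x \<in> space M. real (f x) = real (g x)} \<in> sets M"
    by (rule borel_measurable_eq) measurable
  then show ?thesis by (simp add: pred_def)
qed

section \<open>The data distribution and the measurable structure of the data space\<close>

text \<open>The setting for one fixed distribution. Hoelder smoothness enters through hypotheses of
  single lemmas, and the margin condition only in the final theorem.\<close>

locale data_model = prob_space D for D :: "('a::real_normed_vector \<times> nat) measure" +
  fixes \<X> :: "'a set" and \<eta> :: "'a \<Rightarrow> real" and d :: nat and C\<^sub>d :: real
  assumes data: "data_distribution \<X> D"
    and dim: "intrinsic_dimension \<X> D d C\<^sub>d"
    and Cd_pos: "C\<^sub>d > 0"
    and post: "posterior \<X> D \<eta>"
begin

abbreviation R where "R \<equiv> restrict_space borel \<X>"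

lemma sets_D [measurable_cong]: "sets D = sets (R \<Otimes>\<^sub>M count_space {0, 1})"
  using data unfolding data_distribution_def data_algebra_def by simp

lemma space_R [simp]: "space R = \<X>"
  by (simp add: space_restrict_space)

lemma space_D: "space D = \<X> \<times> {0, 1}"
  using sets_eq_imp_space_eq[OF sets_D] by (simp add: space_pair_measure)

lemma fst_measurable [measurable]: "fst \<in> measurable D R"
  by measurable

lemma snd_measurable [measurable]: "snd \<in> measurable D (count_space UNIV)"
proof -
  have "snd \<in> measurable D (count_space {0, 1})" by measurable
  then show ?thesis
    by (rule measurable_compose) simp
qed

lemma eta_measurable [measurable]: "\<eta> \<in> borel_measurable R"
  using post by (simp add: posterior_def)

lemma norm_measurable [measurable]: "(\<lambda>x. norm (a - x)) \<in> borel_measurable R"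
  by (intro measurable_restrict_space1 borel_measurable_continuous_onI continuous_intros)

lemma ball_measurable [measurable]: "data_ball \<X> x r \<in> sets R"
proof -
  have "data_ball \<X> x r = {y \<in> space R. norm (x - y) \<le> r}"
    by (auto simp: data_ball_def)
  also have "\<dots> \<in> sets R" by measurable
  finally show ?thesis .
qed

text \<open>Total boundedness: the intrinsic dimension gives every ball of radius \<open>e/2\<close>
  a mass bounded below independently of its centre, which limits the size of separated sets.\<close>

lemma finite_net:
  assumes "e > 0"
  shows "\<exists>Q. finite Q \<and> Q \<subseteq> \<X> \<and> (\<forall>x\<in>\<X>. \<exists>q\<in>Q. norm (x - q) \<le> e)"
proof (rule maximal_separated_net)
  fix Q :: "'a set"
  assume Q: "finite Q" "Q \<subseteq> \<X>" "\<And>x y. x \<in> Q \<Longrightarrow> y \<in> Q \<Longrightarrow> x \<noteq> y \<Longrightarrow> norm (x - y) > e"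
  show "real (card Q) \<le> 1 / min (C\<^sub>d * (e/2) ^ d) 1"
    using Q assms Cd_pos dim
    by (intro separated_finite[OF prob_space_axioms, of e _ \<X>])
       (auto simp: intrinsic_dimension_def)
qed fact

lemma countable_dense:
  "\<exists>Q. countable Q \<and> Q \<subseteq> \<X> \<and> (\<forall>x\<in>\<X>. \<forall>e>0. \<exists>q\<in>Q. norm (x - q) < e)"
proof -
  obtain Q where Q: "\<And>e. e > 0 \<Longrightarrow> finite (Q e) \<and> Q e \<subseteq> \<X> \<and> (\<forall>x\<in>\<X>. \<exists>q\<in>Q e. norm (x - q) \<le> e)"
    using finite_net by metis
  let ?Q = "\<Union>m. Q (1 / Suc m)"
  show ?thesis
  proof (intro exI conjI ballI allI impI)
    show "countable ?Q" using Q by (intro countable_UN) (auto intro: countable_finite)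
    show "?Q \<subseteq> \<X>" using Q[of "1 / Suc m" for m] by (intro UN_least) simp
    fix x and e :: real assume "x \<in> \<X>" "0 < e"
    obtain m where m: "1 / Suc m < e" using nat_approx_posE[OF \<open>0 < e\<close>] .
    obtain q where "q \<in> Q (1 / Suc m)" "norm (x - q) \<le> 1 / Suc m"
      using Q[of "1 / Suc m"] \<open>x \<in> \<X>\<close> by auto
    then show "\<exists>q\<in>?Q. norm (x - q) < e" using m by (intro bexI[of _ q]) auto
  qed
qed

text \<open>
  On a nonseparable space the distance need not be measurable for the product of the Borel algebras;
  here the mass condition makes \<open>\<X>\<close> totally bounded.
\<close>

lemma dist_measurable [measurable]:
  "(\<lambda>(x, y). norm (x - y)) \<in> borel_measurable (R \<Otimes>\<^sub>M R)"
proof -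
  obtain Q where Q: "countable Q" "Q \<subseteq> \<X>" "\<And>x e. x \<in> \<X> \<Longrightarrow> e > 0 \<Longrightarrow> \<exists>q\<in>Q. norm (x - q) < e"
    using countable_dense by metis
  show ?thesis
  proof (rule borel_measurable_iff_less[THEN iffD2, rule_format])
    fix a
    \<comment> \<open>Two points are at distance below \<open>a\<close> iff some detour through a
      point \<open>q\<close> of the countable dense set is shorter than \<open>a\<close>; for the
      direction from left to right, \<open>q\<close> is taken within half the slack
      \<open>a - norm (x - y)\<close> of \<open>x\<close>. On the right each condition involves
      distances to a fixed \<open>q\<close> only.\<close>
    have "{p \<in> space (R \<Otimes>\<^sub>M R). (case p of (x, y) \<Rightarrow> norm (x - y)) < a}
        = (\<Union>q\<in>Q. {p \<in> space (R \<Otimes>\<^sub>M R). norm (q - fst p) + norm (q - snd p) < a})" (is "?L = ?R")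
    proof
      show "?R \<subseteq> ?L"
      proof clarsimp
        fix x y q assume "norm (q - x) + norm (q - y) < a"
        moreover have "norm (x - y) \<le> norm (q - x) + norm (q - y)"
          using norm_triangle_ineq4[of "q - y" "q - x"] by simp
        ultimately show "norm (x - y) < a" by simp
      qed
      show "?L \<subseteq> ?R"
      proof (clarsimp simp: space_pair_measure)
        fix x y assume xy: "x \<in> \<X>" "y \<in> \<X>" "norm (x - y) < a"
        then obtain q where q: "q \<in> Q" "norm (x - q) < (a - norm (x - y)) / 2"
          using Q(3)[of x "(a - norm (x - y)) / 2"] by auto
        have "norm (q - y) \<le> norm (x - q) + norm (x - y)"
          using norm_triangle_ineq4[of "x - y" "x - q"] by simp
        then show "\<exists>q\<in>Q. norm (q - x) + norm (q - y) < a"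
          using q by (intro bexI[of _ q]) (auto simp: norm_minus_commute field_simps)
      qed
    qed
    also have "\<dots> \<in> sets (R \<Otimes>\<^sub>M R)"
      by (intro sets.countable_UN'' Q(1)) measurable
    finally show "{p \<in> space (R \<Otimes>\<^sub>M R). (case p of (x, y) \<Rightarrow> norm (x - y)) < a} \<in> sets (R \<Otimes>\<^sub>M R)" .
  qed
qed

section \<open>Conditional law of a label given its point\<close>

text \<open>Labels are 0 or 1, so the weight is affine in the label, and its conditional mean at
  \<open>x\<close> is \<open>a + (b - a) * \<eta> x\<close>.\<close>

abbreviation label_weight :: "real \<Rightarrow> real \<Rightarrow> 'a \<times> nat \<Rightarrow> real" where
  "label_weight a b z \<equiv> if snd z = 1 then b else a"

text \<open>By the characterization of conditional expectation, the label may be replaced by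
  \<open>\<eta>\<close> under the integral against a bounded function of the point; the weight is
  affine in the label.\<close>

lemma label_weight_integral:
  assumes A: "A \<in> sets R"
  shows "(\<integral>z. indicator A (fst z) * label_weight a b z \<partial>D)
       = (\<integral>z. indicator A (fst z) * (a + (b - a) * \<eta> (fst z)) \<partial>D)"
    and "integrable D (\<lambda>z. indicator A (fst z) * (a + (b - a) * \<eta> (fst z)))"
proof -
  let ?F = "vimage_algebra (space D) fst R"
  note [measurable] = A
  have fR: "fst \<in> space D \<rightarrow> space R" by (auto simp: space_D)
  interpret finite_measure_subalgebra D ?F
  proof
    show "subalgebra D ?F"
      unfolding subalgebra_def
      using fst_measurable[unfolded measurable_iff_sets] by simp
  qed
  have fst_F: "fst \<in> measurable ?F R" by (rule measurable_vimage_algebra1[OF fR])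
  have ind: "(\<lambda>z. indicator A (fst z) :: real) \<in> borel_measurable ?F"
    by (rule measurable_compose[OF fst_F]) measurable
  have bdd: "integrable D (\<lambda>z. indicator A (fst z) * real (snd z))"
    by (rule integrable_const_bound[where B = 1]) (auto simp: space_D indicator_def)
  have i1: "integrable D (\<lambda>z. indicator A (fst z) :: real)"
    by (rule integrable_const_bound[where B = 1]) (auto simp: indicator_def)
  have sndm: "(\<lambda>z. real (snd z)) \<in> borel_measurable D" by measurable
  note ce = real_cond_exp_intg[OF bdd ind sndm]
  have ae: "AE z in D. indicator A (fst z) * real_cond_exp D ?F (\<lambda>z. real (snd z)) z
      = indicator A (fst z) * \<eta> (fst z)"
    using post by (auto simp: posterior_def)
  \<comment> \<open>\<open>\<eta>\<close> is only known to agree almost surely with the conditional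
    expectation, so its integrability is inherited from there.\<close>
  have i2: "integrable D (\<lambda>z. indicator A (fst z) * \<eta> (fst z))"
    using ce(1) by (rule integrable_cong_AE_imp[OF _ _ ae]) measurable
  have e2: "(\<integral>z. indicator A (fst z) * \<eta> (fst z) \<partial>D) = (\<integral>z. indicator A (fst z) * real (snd z) \<partial>D)"
    unfolding ce(2)[symmetric] by (rule integral_cong_AE[OF _ _ ae, symmetric]) measurable
  have "(\<integral>z. indicator A (fst z) * label_weight a b z \<partial>D)
      = (\<integral>z. a * indicator A (fst z) + (b - a) * (indicator A (fst z) * real (snd z)) \<partial>D)"
    by (intro Bochner_Integration.integral_cong) (auto simp: space_D algebra_simps)
  also have "\<dots> = a * (\<integral>z. indicator A (fst z) \<partial>D) + (b - a) * (\<integral>z. indicator A (fst z) * real (snd z) \<partial>D)"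
    using i1 bdd by simp
  also have "\<dots> = (\<integral>z. a * indicator A (fst z) + (b - a) * (indicator A (fst z) * \<eta> (fst z)) \<partial>D)"
    using i1 i2 e2 by simp
  also have "\<dots> = (\<integral>z. indicator A (fst z) * (a + (b - a) * \<eta> (fst z)) \<partial>D)"
    by (simp add: algebra_simps)
  finally show "(\<integral>z. indicator A (fst z) * label_weight a b z \<partial>D)
       = (\<integral>z. indicator A (fst z) * (a + (b - a) * \<eta> (fst z)) \<partial>D)" .
  have "integrable D (\<lambda>z. a * indicator A (fst z) + (b - a) * (indicator A (fst z) * \<eta> (fst z)))"
    using i1 i2 by simp
  then show "integrable D (\<lambda>z. indicator A (fst z) * (a + (b - a) * \<eta> (fst z)))"
    by (simp add: algebra_simps)
qed

text \<open>For indicators \<open>f\<close> this follows from the preceding integral identity. The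
  general case comes from reading both sides as integrals of \<open>f\<close> against measures on
  the data space that are comparable set by set.\<close>

lemma label_weight_nn_integral_le:
  assumes B [measurable]: "B \<in> sets R" and ab: "a \<ge> 0" "b \<ge> 0" "q \<ge> 0"
    and q: "\<And>x. x \<in> B \<Longrightarrow> a + (b - a) * \<eta> x \<le> q"
    and f [measurable]: "f \<in> borel_measurable R"
  shows "(\<integral>\<^sup>+z. f (fst z) * (indicator B (fst z) * ennreal (label_weight a b z)) \<partial>D)
       \<le> ennreal q * (\<integral>\<^sup>+z. f (fst z) \<partial>D)"
proof -
  let ?h = "\<lambda>z. indicator B (fst z) * ennreal (label_weight a b z)"
  \<comment> \<open>Images under the first projection of \<open>D\<close> with density the
    restricted label weight, and of \<open>D\<close> with constant density \<open>q\<close>.\<close>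
  let ?M = "distr (density D ?h) R fst" and ?N = "distr (density D (\<lambda>_. ennreal q)) R fst"
  have [measurable]: "?h \<in> borel_measurable D" by measurable
  have "emeasure ?M A \<le> emeasure ?N A" if [measurable]: "A \<in> sets R" for A
  proof -
    have AB: "A \<inter> B \<in> sets R" by measurable
    have "emeasure ?M A = (\<integral>\<^sup>+z. ennreal (indicator (A \<inter> B) (fst z) * label_weight a b z) \<partial>D)"
      by (subst emeasure_distr, simp, simp, subst emeasure_density)
         (auto intro!: nn_integral_cong simp: indicator_def)
    also have "\<dots> = ennreal (\<integral>z. indicator (A \<inter> B) (fst z) * label_weight a b z \<partial>D)"
      using ab by (intro nn_integral_eq_integral integrable_const_bound[where B = "max a b"])
        (auto simp: indicator_def)
    also have "\<dots> \<le> ennreal (\<integral>z. indicator A (fst z) * q \<partial>D)"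
    proof (rule ennreal_leI)
      show "(\<integral>z. indicator (A \<inter> B) (fst z) * label_weight a b z \<partial>D) \<le> (\<integral>z. indicator A (fst z) * q \<partial>D)"
        unfolding label_weight_integral(1)[OF AB] using q ab
        by (intro integral_mono label_weight_integral(2)[OF AB] integrable_const_bound[where B = q])
           (auto simp: indicator_def)
    qed
    also have "\<dots> = (\<integral>\<^sup>+z. ennreal (indicator A (fst z) * q) \<partial>D)"
      using ab by (intro nn_integral_eq_integral[symmetric] integrable_const_bound[where B = q])
        (auto simp: indicator_def)
    also have "\<dots> = emeasure ?N A"
      by (subst emeasure_distr, simp, simp, subst emeasure_density)
         (auto intro!: nn_integral_cong simp: indicator_def)
    finally show ?thesis .
  qed
  then have "?M \<le> ?N"
    by (simp add: le_measure)
  then have "nn_integral ?M f \<le> nn_integral ?N f"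
    by (intro nn_integral_mono_measure) auto
  then show ?thesis
    by (simp add: nn_integral_distr nn_integral_density nn_integral_cmult mult.commute)
qed

section \<open>The sample and measurability of the nearest neighbor rule\<close>

abbreviation "P n \<equiv> iid_sample D n"

lemma product_sigma_finite_D: "product_sigma_finite (\<lambda>_::nat. D)"
  by (simp add: product_sigma_finite_def sigma_finite_measure_axioms)

lemma prob_space_sample: "prob_space (P n)"
  unfolding iid_sample_def by (intro prob_space_PiM prob_space_axioms)

lemma sample_component [measurable]: "i < n \<Longrightarrow> (\<lambda>S. S i) \<in> measurable (P n) D"
  unfolding iid_sample_def by measurable

lemma space_sample: "S \<in> space (P n) \<Longrightarrow> i < n \<Longrightarrow> fst (S i) \<in> \<X> \<and> snd (S i) \<in> {0, 1}"
  using measurable_space[OF sample_component, of i n S] by (auto simp: space_D)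

lemma neighbor_dist_measurable [measurable]:
  assumes [measurable]: "i < n"
  shows "(\<lambda>p. norm (snd p - fst (fst p i))) \<in> borel_measurable (P n \<Otimes>\<^sub>M R)"
proof -
  have "(\<lambda>p. (snd p, fst (fst p i))) \<in> measurable (P n \<Otimes>\<^sub>M R) (R \<Otimes>\<^sub>M R)"
    by measurable
  from measurable_compose[OF this dist_measurable] show ?thesis by simp
qed

lemma in_neighbors_measurable [measurable]:
  "Measurable.pred (P n \<Otimes>\<^sub>M R) (\<lambda>p. i \<in> nearest_neighbors k n (fst p) (snd p))"
proof (cases "i < n")
  case True
  then show ?thesis
    unfolding nearest_neighbors_def card_Collect_less_eq_sum by measurable
qed (simp add: nearest_neighbors_def)

text \<open>The values lie in the finite set \<open>Pow {..<n}\<close>, so preimages of single index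
  sets suffice, and each of these is a finite conjunction of membership conditions.\<close>

lemma neighbors_measurable [measurable]:
  "(\<lambda>p. nearest_neighbors k n (fst p) (snd p)) \<in> measurable (P n \<Otimes>\<^sub>M R) (count_space UNIV)"
proof -
  have "(\<lambda>p. nearest_neighbors k n (fst p) (snd p)) \<in> measurable (P n \<Otimes>\<^sub>M R) (count_space (Pow {..<n}))"
  proof (subst measurable_count_space_eq2, simp, intro conjI ballI)
    show "(\<lambda>p. nearest_neighbors k n (fst p) (snd p)) \<in> space (P n \<Otimes>\<^sub>M R) \<rightarrow> Pow {..<n}"
      by (auto simp: nearest_neighbors_def)
    fix I assume I: "I \<in> Pow {..<n}"
    have "(\<lambda>p. nearest_neighbors k n (fst p) (snd p)) -` {I} \<inter> space (P n \<Otimes>\<^sub>M R)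
      = {p \<in> space (P n \<Otimes>\<^sub>M R). \<forall>i\<in>{..<n}. i \<in> nearest_neighbors k n (fst p) (snd p) \<longleftrightarrow> i \<in> I}"
      using I by (auto simp: nearest_neighbors_def)
    also have "\<dots> \<in> sets (P n \<Otimes>\<^sub>M R)" by measurable
    finally show "(\<lambda>p. nearest_neighbors k n (fst p) (snd p)) -` {I} \<inter> space (P n \<Otimes>\<^sub>M R) \<in> sets (P n \<Otimes>\<^sub>M R)" .
  qed
  then show ?thesis by (rule measurable_compose) simp
qed

lemma classifier_measurable [measurable]:
  "(\<lambda>p. knn_classifier k n (fst p) (snd p)) \<in> measurable (P n \<Otimes>\<^sub>M R) (count_space UNIV)"
proof -
  have [measurable]: "(\<lambda>p. (of_bool (i \<in> nearest_neighbors k n (fst p) (snd p) \<and> snd (fst p i) = 1) :: real))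
      \<in> borel_measurable (P n \<Otimes>\<^sub>M R)" if [measurable]: "i < n" for i
    unfolding of_bool_def by measurable
  have "(\<lambda>p. eta_hat k n (fst p) (snd p)) \<in> borel_measurable (P n \<Otimes>\<^sub>M R)"
    unfolding eta_hat_def by measurable
  then show ?thesis unfolding knn_classifier_def of_bool_def by measurable
qed

lemma Pair_sample_measurable [measurable]: "x \<in> \<X> \<Longrightarrow> (\<lambda>S. (S, x)) \<in> measurable (P n) (P n \<Otimes>\<^sub>M R)"
  by (simp add: measurable_Pair2')

lemma neighbors_measurable1 [measurable]:
  "x \<in> \<X> \<Longrightarrow> (\<lambda>S. nearest_neighbors k n S x) \<in> measurable (P n) (count_space UNIV)"
  using measurable_compose[OF Pair_sample_measurable neighbors_measurable] by simp

lemma classifier_measurable1 [measurable]: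
  "x \<in> \<X> \<Longrightarrow> (\<lambda>S. knn_classifier k n S x) \<in> measurable (P n) (count_space UNIV)"
  using measurable_compose[OF Pair_sample_measurable classifier_measurable] by simp

section \<open>Deviation of the labels of the neighbors\<close>

text \<open>
  Conditioning on the unlabeled sample is replaced by integrating out one label at a time: the weight
  \<open>g\<close> sees only the points, so each label still has its conditional law given its own point.
\<close>

lemma label_weights_integral_le:
  assumes B [measurable]: "B \<in> sets R" and ab: "a \<ge> 0" "b \<ge> 0" "q \<ge> 0"
    and q: "\<And>x. x \<in> B \<Longrightarrow> a + (b - a) * \<eta> x \<le> q"
    and g [measurable]: "g \<in> borel_measurable (P n)"
    and unlabeled: "\<And>S S'. (\<And>i. fst (S i) = fst (S' i)) \<Longrightarrow> g S = g S'"
    and J: "J \<subseteq> {..<n}"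
  shows "(\<integral>\<^sup>+S. g S * (\<Prod>i\<in>J. indicator B (fst (S i)) * ennreal (label_weight a b (S i))) \<partial>P n)
       \<le> ennreal q ^ card J * (\<integral>\<^sup>+S. g S \<partial>P n)"
proof -
  interpret product_sigma_finite "\<lambda>_::nat. D" by (rule product_sigma_finite_D)
  let ?h = "\<lambda>z. indicator B (fst z) * ennreal (label_weight a b z)"
  have h [measurable]: "?h \<in> borel_measurable D" by measurable
  have "finite J" using J finite_subset by blast
  then show ?thesis using J
  proof induction
    case empty
    then show ?case by simp
  next
    case (insert i J)
    then have i [measurable]: "i < n" and J: "J \<subseteq> {..<n}" by auto
    let ?G = "\<lambda>S. g S * (\<Prod>j\<in>J. ?h (S j))"
    have [measurable]: "(\<lambda>S. ?h (S j)) \<in> borel_measurable (P n)" if "j \<in> J" for j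
      using J that by (intro measurable_compose[OF sample_component h]) auto
    have G: "?G \<in> borel_measurable (P n)" by measurable
    have "(\<integral>\<^sup>+S. ?G S * ?h (S i) \<partial>Pi\<^sub>M {..<n} (\<lambda>_. D)) \<le> ennreal q * (\<integral>\<^sup>+S. ?G S \<partial>Pi\<^sub>M {..<n} (\<lambda>_. D))"
    proof (rule nn_integral_PiM_coordinate_le)
      fix S assume S: "S \<in> space (Pi\<^sub>M ({..<n} - {i}) (\<lambda>_. D))"
      \<comment> \<open>The integrand sees only the point in coordinate \<open>i\<close>:
        \<open>g\<close> ignores labels and \<open>i\<close> is not in \<open>J\<close>. The label
        there may therefore be set to a default; 0 is chosen as an admissible label, which keeps the
        update measurable.\<close>
      define f where "f = (\<lambda>y. ?G (S(i := (y, 0))))"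
      have "(\<lambda>y. S(i := (y, 0))) \<in> measurable R (P n)"
        unfolding iid_sample_def
      proof (rule measurable_fun_upd[where J = "{..<n} - {i}"])
        show "{..<n} = {..<n} - {i} \<union> {i}" using i by auto
        show "(\<lambda>y. S) \<in> R \<rightarrow>\<^sub>M Pi\<^sub>M ({..<n} - {i}) (\<lambda>_. D)" using S by simp
        show "(\<lambda>y. (y, 0)) \<in> R \<rightarrow>\<^sub>M D"
          unfolding measurable_cong_sets[OF refl sets_D] by measurable
      qed
      from measurable_compose[OF this G] have f: "f \<in> borel_measurable R"
        unfolding f_def .
      have "?G (S(i := z)) = f (fst z)" for z
      proof -
        have "g (S(i := z)) = g (S(i := (fst z, 0)))" by (rule unlabeled) simp
        moreover have "(\<Prod>j\<in>J. ?h ((S(i := z)) j)) = (\<Prod>j\<in>J. ?h ((S(i := (fst z, 0))) j))"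
          using insert.hyps by (intro prod.cong) auto
        ultimately show ?thesis unfolding f_def by metis
      qed
      then show "(\<integral>\<^sup>+z. ?G (S(i := z)) * ?h z \<partial>D) \<le> ennreal q * (\<integral>\<^sup>+z. ?G (S(i := z)) \<partial>D)"
        using label_weight_nn_integral_le[OF B ab q f] by simp
    qed (use G i in \<open>auto simp: iid_sample_def\<close>)
    also have "\<dots> \<le> ennreal q * (ennreal q ^ card J * (\<integral>\<^sup>+S. g S \<partial>P n))"
      using insert.IH[OF J] by (intro mult_left_mono) (simp_all add: iid_sample_def)
    finally show ?case using insert.hyps by (simp add: iid_sample_def mult_ac)
  qed
qed

text \<open>An exponential Markov inequality on each event that the neighbor set is a given
  \<open>I\<close>. On \<open>W\<close> the product of the \<open>k\<close> weights is at least 1,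
  and the event depends on the points only, so its weighted integral is at most \<open>q ^ k\<close>
  times its probability. Events for different \<open>I\<close> are disjoint, hence summing over
  \<open>I\<close> costs no combinatorial factor.\<close>

lemma label_deviation_bound:
  assumes B [measurable]: "B \<in> sets R" and ab: "a \<ge> 0" "b \<ge> 0" "q \<ge> 0"
    and q: "\<And>x. x \<in> B \<Longrightarrow> a + (b - a) * \<eta> x \<le> q"
    and x [measurable]: "x \<in> \<X>"
    and W: "\<And>S. S \<in> space (P n) \<Longrightarrow> W S \<Longrightarrow> card (nearest_neighbors k n S x) = k \<Longrightarrow>
      1 \<le> (\<Prod>i\<in>nearest_neighbors k n S x. label_weight a b (S i))"
  shows "(\<integral>\<^sup>+S. indicator {S. card (nearest_neighbors k n S x) = k \<and>
      (\<forall>i\<in>nearest_neighbors k n S x. fst (S i) \<in> B) \<and> W S} S \<partial>P n) \<le> ennreal (q ^ k)"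
proof -
  interpret P: prob_space "P n" by (rule prob_space_sample)
  let ?N = "\<lambda>S. nearest_neighbors k n S x"
  let ?h = "\<lambda>z. indicator B (fst z) * ennreal (label_weight a b z)"
  let ?\<I> = "{I. I \<subseteq> {..<n} \<and> card I = k}"
  have fin: "finite ?\<I>" by (rule finite_subset[of _ "Pow {..<n}"]) auto
  have h [measurable]: "?h \<in> borel_measurable D" by measurable
  have ind: "(\<lambda>S. indicator {S. ?N S = I} S :: ennreal) \<in> borel_measurable (P n)" for I
    unfolding indicator_def by measurable
  have hJ: "(\<lambda>S. \<Prod>i\<in>I. ?h (S i)) \<in> borel_measurable (P n)" if "I \<subseteq> {..<n}" for I
    using that by (intro borel_measurable_prod_ennreal measurable_compose[OF sample_component h]) auto
  have "(\<integral>\<^sup>+S. indicator {S. card (?N S) = k \<and> (\<forall>i\<in>?N S. fst (S i) \<in> B) \<and> W S} S \<partial>P n)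
      \<le> (\<integral>\<^sup>+S. (\<Sum>I\<in>?\<I>. indicator {S. ?N S = I} S * (\<Prod>i\<in>I. ?h (S i))) \<partial>P n)"
  proof (rule nn_integral_mono)
    fix S assume S: "S \<in> space (P n)"
    show "indicator {S. card (?N S) = k \<and> (\<forall>i\<in>?N S. fst (S i) \<in> B) \<and> W S} S
      \<le> (\<Sum>I\<in>?\<I>. indicator {S. ?N S = I} S * (\<Prod>i\<in>I. ?h (S i)))"
    proof (cases "card (?N S) = k \<and> (\<forall>i\<in>?N S. fst (S i) \<in> B) \<and> W S")
      case True
      have sub: "?N S \<in> ?\<I>" using True by (auto simp: nearest_neighbors_def)
      have "(1::ennreal) \<le> ennreal (\<Prod>i\<in>?N S. label_weight a b (S i))"
        using W[OF S] True by (simp flip: ennreal_1 add: ennreal_leI)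
      also have "\<dots> = (\<Prod>i\<in>?N S. ennreal (label_weight a b (S i)))"
        using ab by (intro prod_ennreal[symmetric]) auto
      also have "\<dots> = (\<Prod>i\<in>?N S. ?h (S i))"
        using True by (intro prod.cong) auto
      also have "\<dots> = indicator {S'. ?N S' = ?N S} S * (\<Prod>i\<in>?N S. ?h (S i))" by simp
      also have "\<dots> \<le> (\<Sum>I\<in>?\<I>. indicator {S. ?N S = I} S * (\<Prod>i\<in>I. ?h (S i)))"
        by (rule member_le_sum[OF sub _ fin, of "\<lambda>I. indicator {S'. ?N S' = I} S * (\<Prod>i\<in>I. ?h (S i))"]) simp
      finally show ?thesis using True by simp
    qed simp
  qed
  also have "\<dots> = (\<Sum>I\<in>?\<I>. \<integral>\<^sup>+S. indicator {S. ?N S = I} S * (\<Prod>i\<in>I. ?h (S i)) \<partial>P n)"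
    using ind hJ by (intro nn_integral_sum borel_measurable_times) auto
  also have "\<dots> \<le> (\<Sum>I\<in>?\<I>. ennreal q ^ k * (\<integral>\<^sup>+S. indicator {S. ?N S = I} S \<partial>P n))"
  proof (rule sum_mono)
    fix I assume I: "I \<in> ?\<I>"
    have "(\<integral>\<^sup>+S. indicator {S. ?N S = I} S * (\<Prod>i\<in>I. ?h (S i)) \<partial>P n)
        \<le> ennreal q ^ card I * (\<integral>\<^sup>+S. indicator {S. ?N S = I} S \<partial>P n)"
      using I by (intro label_weights_integral_le[OF B ab q ind]) (auto simp: nearest_neighbors_def indicator_def)
    then show "(\<integral>\<^sup>+S. indicator {S. ?N S = I} S * (\<Prod>i\<in>I. ?h (S i)) \<partial>P n)
        \<le> ennreal q ^ k * (\<integral>\<^sup>+S. indicator {S. ?N S = I} S \<partial>P n)" using I by simp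
  qed
  also have "\<dots> = ennreal q ^ k * (\<integral>\<^sup>+S. (\<Sum>I\<in>?\<I>. indicator {S. ?N S = I} S) \<partial>P n)"
    using ind by (subst nn_integral_sum) (auto simp: sum_distrib_left)
  also have "\<dots> \<le> ennreal q ^ k * (\<integral>\<^sup>+S. 1 \<partial>P n)"
  proof (intro mult_left_mono nn_integral_mono)
    fix S
    show "(\<Sum>I\<in>?\<I>. indicator {S. ?N S = I} S) \<le> (1::ennreal)"
    proof (cases "?N S \<in> ?\<I>")
      case True
      have "(\<Sum>I\<in>?\<I>. indicator {S. ?N S = I} S) = (\<Sum>I\<in>{?N S}. indicator {S. ?N S = I} S :: ennreal)"
        using True fin by (intro sum.mono_neutral_right) (auto simp: indicator_def)
      then show ?thesis by simp
    next
      case False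
      then have "(\<Sum>I\<in>?\<I>. indicator {S. ?N S = I} S) = (0::ennreal)"
        by (intro sum.neutral) (auto simp: indicator_def)
      then show ?thesis by simp
    qed
  qed simp
  also have "\<dots> = ennreal (q ^ k)"
    using ab by (simp add: P.emeasure_space_1 ennreal_power)
  finally show ?thesis .
qed

section \<open>Chernoff bound for the number of sample points in a ball\<close>

text \<open>With weight 1/2 on sample points in \<open>B\<close> and 1 elsewhere, fewer than
  \<open>k\<close> hits make \<open>2 ^ k\<close> times the product of the weights at least 1. By
  independence the product has mean at most \<open>exp (- n * p / 2)\<close>, hence at most
  \<open>exp (- 2 * k)\<close>.\<close>

lemma few_points_bound:
  assumes B [measurable]: "B \<in> sets R" and p: "\<P>(z in D. fst z \<in> B) \<ge> p"
    and np: "real n * p \<ge> 4 * real k"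
  shows "(\<integral>\<^sup>+S. indicator {S. card {j\<in>{..<n}. fst (S j) \<in> B} < k} S \<partial>P n) \<le> ennreal (exp (- real k))"
proof -
  interpret product_sigma_finite "\<lambda>_::nat. D" by (rule product_sigma_finite_D)
  let ?p = "\<P>(z in D. fst z \<in> B)"
  define w :: "'a \<times> nat \<Rightarrow> real" where "w z = (if fst z \<in> B then 1/2 else 1)" for z
  have w [measurable]: "w \<in> borel_measurable D" unfolding w_def by measurable
  have w0: "w z \<ge> 0" for z by (simp add: w_def)
  have set: "{z \<in> space D. fst z \<in> B} \<in> sets D" by measurable
  have p1: "0 \<le> 1 - ?p / 2" using prob_le_1[of "{z \<in> space D. fst z \<in> B}"] by linarith
  have ind: "integrable D (\<lambda>z. indicator {z \<in> space D. fst z \<in> B} z / 2 :: real)"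
    using set by (intro integrable_const_bound[where B = 1]) (auto simp: indicator_def)
  have "(\<integral>\<^sup>+z. ennreal (w z) \<partial>D) = ennreal (\<integral>z. w z \<partial>D)"
    by (intro nn_integral_eq_integral integrable_const_bound[where B = 1]) (auto simp: w_def)
  also have "(\<integral>z. w z \<partial>D) = (\<integral>z. 1 - 1/2 * indicator {z \<in> space D. fst z \<in> B} z \<partial>D)"
    by (intro Bochner_Integration.integral_cong) (auto simp: w_def)
  also have "\<dots> = 1 - ?p / 2"
    using set ind by (subst Bochner_Integration.integral_diff) (simp_all add: prob_space)
  finally have int: "(\<integral>\<^sup>+z. ennreal (w z) \<partial>D) = ennreal (1 - ?p / 2)" .
  have "(\<integral>\<^sup>+S. indicator {S. card {j\<in>{..<n}. fst (S j) \<in> B} < k} S \<partial>P n)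
      \<le> (\<integral>\<^sup>+S. ennreal (2 ^ k) * (\<Prod>j<n. ennreal (w (S j))) \<partial>P n)"
  proof (rule nn_integral_mono)
    fix S :: "nat \<Rightarrow> 'a \<times> nat"
    let ?c = "card {j\<in>{..<n}. fst (S j) \<in> B}"
    show "indicator {S. card {j\<in>{..<n}. fst (S j) \<in> B} < k} S \<le> ennreal (2 ^ k) * (\<Prod>j<n. ennreal (w (S j)))"
    proof (cases "?c < k")
      case True
      have "(1::real) \<le> 2 ^ (k - ?c)" by simp
      also have "\<dots> = 2 ^ k * (1/2) ^ ?c" using True by (simp add: power_diff power_divide)
      also have "\<dots> = 2 ^ k * (\<Prod>j<n. w (S j))"
        unfolding w_def by (subst prod_if_const) simp_all
      finally show ?thesis using True w0
        by (simp add: prod_ennreal ennreal_mult[symmetric] prod_nonneg flip: ennreal_1 del: ennreal_1)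
    qed simp
  qed
  also have "\<dots> = ennreal (2 ^ k) * (\<Prod>j<n. (\<integral>\<^sup>+z. ennreal (w z) \<partial>D))"
    unfolding iid_sample_def
    by (subst nn_integral_cmult) (simp_all add: product_nn_integral_prod[where f = "\<lambda>_ z. ennreal (w z)"])
  also have "\<dots> = ennreal (2 ^ k * (1 - ?p / 2) ^ n)"
    by (simp add: int ennreal_power[OF p1] ennreal_mult' del: ennreal_plus)
  also have "\<dots> \<le> ennreal (exp (- real k))"
  proof (rule ennreal_leI)
    have "(1 - ?p / 2) ^ n \<le> exp (- p / 2) ^ n"
      using p p1 exp_ge_add_one_self[of "- ?p / 2"]
      by (intro power_mono order_trans[OF _ exp_le_cancel_iff[THEN iffD2, of "- ?p / 2" "- p / 2"]]) auto
    also have "\<dots> = exp (- (real n * p) / 2)" by (simp add: exp_of_nat_mult[symmetric])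
    also have "\<dots> \<le> exp (- 2 * real k)" using np by simp
    finally have *: "(1 - ?p / 2) ^ n \<le> exp (- 2 * real k)" .
    \<comment> \<open>Since 2 is at most \<open>exp 1\<close>, the factor \<open>2 ^ k\<close> uses
      up only half of the exponent \<open>2 * k\<close>.\<close>
    have "(2::real) ^ k \<le> exp 1 ^ k"
      using exp_ge_add_one_self[of 1] by (intro power_mono) auto
    then have "2 ^ k * (1 - ?p / 2) ^ n \<le> exp (real k) * exp (- 2 * real k)"
      using * p1 by (intro mult_mono zero_le_power) (auto simp: exp_of_nat_mult[symmetric])
    then show "2 ^ k * (1 - ?p / 2) ^ n \<le> exp (- real k)"
      by (simp add: exp_add[symmetric])
  qed
  finally show ?thesis .
qed

text \<open>A sample point outside the ball is farther than \<open>r\<close> from \<open>x\<close>,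
  so all sample points in the ball are strictly closer; a neighbor has fewer than \<open>k\<close>
  strictly closer points.\<close>

lemma far_neighbor_few_points:
  assumes "S \<in> space (P n)" "i \<in> nearest_neighbors k n S x" "fst (S i) \<notin> data_ball \<X> x r"
  shows "card {j\<in>{..<n}. fst (S j) \<in> data_ball \<X> x r} < k"
proof -
  have i: "i < n" and lt: "card {j. j < n \<and> norm (x - fst (S j)) < norm (x - fst (S i))} < k"
    using assms(2) by (auto simp: nearest_neighbors_def)
  have far: "norm (x - fst (S i)) > r"
    using assms(3) space_sample[OF assms(1) i] by (auto simp: data_ball_def)
  have "card {j\<in>{..<n}. fst (S j) \<in> data_ball \<X> x r}
      \<le> card {j. j < n \<and> norm (x - fst (S j)) < norm (x - fst (S i))}"
    using far by (intro card_mono) (auto simp: data_ball_def)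
  then show ?thesis using lt by simp
qed

section \<open>Disagreement of the two classifiers at a fixed point\<close>

lemma bayes_measurable [measurable]: "bayes_classifier \<eta> \<in> measurable R (count_space UNIV)"
  unfolding bayes_classifier_def of_bool_def by measurable

lemma sample_point_measurable [measurable]:
  "(\<lambda>p. (fst p, fst (snd p))) \<in> measurable (P n \<Otimes>\<^sub>M D) (P n \<Otimes>\<^sub>M R)"
  by measurable

lemma neighbors_measurable2 [measurable]:
  "(\<lambda>p. nearest_neighbors k n (fst p) (fst (snd p))) \<in> measurable (P n \<Otimes>\<^sub>M D) (count_space UNIV)"
  using measurable_compose[OF sample_point_measurable neighbors_measurable] by simp

lemma classifier_measurable2 [measurable]:
  "(\<lambda>p. knn_classifier k n (fst p) (fst (snd p))) \<in> measurable (P n \<Otimes>\<^sub>M D) (count_space UNIV)"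
  using measurable_compose[OF sample_point_measurable classifier_measurable] by simp

lemma eta_hat_eq_card:
  "eta_hat k n S x = real (card {i \<in> nearest_neighbors k n S x. snd (S i) = 1}) / real k"
proof -
  have "{..<n} \<inter> {i. i \<in> nearest_neighbors k n S x \<and> snd (S i) = 1}
      = {i \<in> nearest_neighbors k n S x. snd (S i) = 1}"
    by (auto simp: nearest_neighbors_def)
  then show ?thesis by (simp add: eta_hat_def of_bool_def sum.If_cases)
qed

lemma finite_neighbors [simp]: "finite (nearest_neighbors k n S x)"
  by (rule finite_subset[of _ "{..<n}"]) (auto simp: nearest_neighbors_def)

text \<open>On \<open>B\<close> the posterior stays at least \<open>\<delta>\<close> away from 1/2,
  on the side of \<open>\<eta> x\<close>. Disagreement then means that the labels contrary to this
  side are at least half of the \<open>k\<close>, which the tilted weights bound by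
  \<open>(1 - \<delta>\<^sup>2) ^ k\<close>.\<close>

lemma label_deviation_classifier_bound:
  assumes smooth: "\<And>y. y \<in> B \<Longrightarrow> \<bar>\<eta> y - \<eta> x\<bar> \<le> \<delta>"
    and B: "B \<in> sets R" and \<delta>: "0 \<le> \<delta>" "\<delta> \<le> 1/2" and margin: "\<bar>1/2 - \<eta> x\<bar> > 2 * \<delta>"
    and x: "x \<in> \<X>" and k: "k \<ge> 1"
  shows "(\<integral>\<^sup>+S. indicator {S. card (nearest_neighbors k n S x) = k \<and>
      (\<forall>i\<in>nearest_neighbors k n S x. fst (S i) \<in> B) \<and> knn_classifier k n S x \<noteq> bayes_classifier \<eta> x} S \<partial>P n)
      \<le> ennreal (exp (- real k * \<delta>\<^sup>2))"
proof -
  define a b where "a = 1 - \<delta>" and "b = 1 + \<delta> + 2 * \<delta>\<^sup>2"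
  let ?N = "\<lambda>S. nearest_neighbors k n S x"
  let ?I = "\<integral>\<^sup>+S. indicator {S. card (?N S) = k \<and> (\<forall>i\<in>?N S. fst (S i) \<in> B) \<and>
      knn_classifier k n S x \<noteq> bayes_classifier \<eta> x} S \<partial>P n"
  have sq: "\<delta>\<^sup>2 \<le> 1" using \<delta> power_mono[of \<delta> 1 2] by simp
  have ab: "a \<ge> 0" "b \<ge> 0" "1 - \<delta>\<^sup>2 \<ge> 0" using \<delta> sq by (auto simp: a_def b_def)
  let ?ones = "\<lambda>S. card {i\<in>?N S. snd (S i) = 1}" and ?zeros = "\<lambda>S. card {i\<in>?N S. snd (S i) \<noteq> 1}"
  have split: "?ones S + ?zeros S = k" if "card (?N S) = k" for S
    using card_split[of "?N S" "\<lambda>i. snd (S i) = 1"] that by simp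
  have "?I \<le> ennreal ((1 - \<delta>\<^sup>2) ^ k)"
  proof (cases "\<eta> x < 1/2")
    case True
    show ?thesis
    proof (rule label_deviation_bound[OF B ab(1) ab(2) ab(3) _ x])
      fix y assume "y \<in> B"
      then have "\<eta> y \<le> 1/2 - \<delta>" using smooth[of y] margin True by linarith
      then show "a + (b - a) * \<eta> y \<le> 1 - \<delta>\<^sup>2"
        unfolding a_def b_def using tilted_weights_mean_le \<delta> by simp
    next
      fix S assume S: "knn_classifier k n S x \<noteq> bayes_classifier \<eta> x" "card (?N S) = k"
      then have "eta_hat k n S x \<ge> 1/2"
        using True by (auto simp: knn_classifier_def bayes_classifier_def of_bool_def split: if_splits)
      then have "real (?ones S) / real k \<ge> 1/2" by (simp add: eta_hat_eq_card)
      \<comment> \<open>The classifier answers 1 also when exactly half of the labels are 1, so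
        equality must be allowed here.\<close>
      then have "?zeros S \<le> ?ones S" using split[OF S(2)] k by (simp add: field_simps)
      from tilted_weights_power_ge_one[OF \<delta> this]
      show "1 \<le> (\<Prod>i\<in>?N S. label_weight a b (S i))"
        unfolding a_def b_def by (subst prod_if_const) (simp_all add: mult.commute)
    qed
  next
    case False
    \<comment> \<open>The mirror case: label 0 is now the contrary one, with conditional probability
      \<open>1 - \<eta> y\<close>, so the two weights exchange places.\<close>
    show ?thesis
    proof (rule label_deviation_bound[OF B ab(2) ab(1) ab(3) _ x])
      fix y assume "y \<in> B"
      then have "1 - \<eta> y \<le> 1/2 - \<delta>" using smooth[of y] margin False by linarith
      from tilted_weights_mean_le[OF \<delta>(1) this]
      show "b + (a - b) * \<eta> y \<le> 1 - \<delta>\<^sup>2"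
        unfolding a_def b_def by (simp add: algebra_simps)
    next
      fix S assume S: "knn_classifier k n S x \<noteq> bayes_classifier \<eta> x" "card (?N S) = k"
      then have "eta_hat k n S x < 1/2"
        using False by (auto simp: knn_classifier_def bayes_classifier_def of_bool_def split: if_splits)
      then have "real (?ones S) / real k < 1/2" by (simp add: eta_hat_eq_card)
      then have "?ones S \<le> ?zeros S" using split[OF S(2)] k by (simp add: field_simps)
      from tilted_weights_power_ge_one[OF \<delta> this]
      show "1 \<le> (\<Prod>i\<in>?N S. label_weight b a (S i))"
        unfolding a_def b_def by (subst prod_if_const) simp_all
    qed
  qed
  also have "(1 - \<delta>\<^sup>2) ^ k \<le> exp (- \<delta>\<^sup>2) ^ k"
    using ab(3) exp_ge_add_one_self[of "- \<delta>\<^sup>2"] by (intro power_mono) simp_all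
  then have "ennreal ((1 - \<delta>\<^sup>2) ^ k) \<le> ennreal (exp (- real k * \<delta>\<^sup>2))"
    by (intro ennreal_leI) (simp add: exp_of_nat_mult[symmetric])
  finally show ?thesis .
qed

text \<open>Either all neighbors lie in the ball of radius \<open>r\<close>, where Hoelder
  smoothness keeps \<open>\<eta>\<close> within \<open>\<delta>\<close> of \<open>\<eta> x\<close>,
  or the ball contains fewer than \<open>k\<close> sample points. The second case has probability at
  most \<open>exp (- k)\<close>, which the bound for the first dominates as \<open>\<delta>\<close>
  is below 1.\<close>

lemma pointwise_disagreement_bound:
  assumes hs: "hoelder_smooth \<X> \<eta> lam ups" and pos: "lam > 0" "ups > 0" "r > 0"
    and \<delta>: "0 \<le> \<delta>" "\<delta> \<le> 1/2" and r: "lam * r powr ups \<le> \<delta>"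
    and margin: "\<bar>1/2 - \<eta> x\<bar> > 2 * \<delta>"
    and x [measurable]: "x \<in> \<X>" and k: "k \<ge> 1" and mass: "real n * min (C\<^sub>d * r ^ d) 1 \<ge> 4 * real k"
  shows "(\<integral>\<^sup>+S. indicator {S. card (nearest_neighbors k n S x) = k \<and>
      knn_classifier k n S x \<noteq> bayes_classifier \<eta> x} S \<partial>P n) \<le> ennreal (2 * exp (- real k * \<delta>\<^sup>2))"
proof -
  let ?B = "data_ball \<X> x r" and ?N = "\<lambda>S. nearest_neighbors k n S x"
  let ?dev = "{S. card (?N S) = k \<and> (\<forall>i\<in>?N S. fst (S i) \<in> ?B) \<and> knn_classifier k n S x \<noteq> bayes_classifier \<eta> x}"
  let ?few = "{S. card {j\<in>{..<n}. fst (S j) \<in> ?B} < k}"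
  have smooth: "\<bar>\<eta> y - \<eta> x\<bar> \<le> \<delta>" if "y \<in> ?B" for y
  proof -
    have y: "y \<in> \<X>" "norm (y - x) \<le> r" using that by (auto simp: data_ball_def norm_minus_commute)
    have "\<bar>\<eta> y - \<eta> x\<bar> \<le> lam * norm (y - x) powr ups"
      using hs x y by (auto simp: hoelder_smooth_def)
    also have "\<dots> \<le> lam * r powr ups"
      using pos y by (intro mult_left_mono powr_mono2) auto
    finally show ?thesis using r by simp
  qed
  \<comment> \<open>Quantifying over the fixed index set \<open>{..<n}\<close> instead of the random
    neighbor set exhibits the event as a finite conjunction of measurable ones.\<close>
  have in_N: "(\<forall>i\<in>?N S. fst (S i) \<in> ?B) \<longleftrightarrow> (\<forall>i\<in>{..<n}. i \<in> ?N S \<longrightarrow> fst (S i) \<in> ?B)" for S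
    by (auto simp: nearest_neighbors_def)
  have [measurable]: "Measurable.pred (P n) (\<lambda>S. i \<in> ?N S)" for i
    by (rule measurable_compose[OF neighbors_measurable1[OF x]]) simp
  have dev: "(indicator ?dev :: _ \<Rightarrow> ennreal) \<in> borel_measurable (P n)"
    unfolding indicator_def mem_Collect_eq in_N by measurable
  have few: "(indicator ?few :: _ \<Rightarrow> ennreal) \<in> borel_measurable (P n)"
    unfolding indicator_def mem_Collect_eq lessThan_iff card_Collect_less_eq_sum by measurable
  have "(\<integral>\<^sup>+S. indicator {S. card (?N S) = k \<and> knn_classifier k n S x \<noteq> bayes_classifier \<eta> x} S \<partial>P n)
      \<le> (\<integral>\<^sup>+S. indicator ?dev S + indicator ?few S \<partial>P n)"
    using far_neighbor_few_points[of _ n _ k x r]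
    by (intro nn_integral_mono) (auto simp: indicator_def)
  also have "\<dots> = (\<integral>\<^sup>+S. indicator ?dev S \<partial>P n) + (\<integral>\<^sup>+S. indicator ?few S \<partial>P n)"
    by (rule nn_integral_add[OF dev few])
  also have "\<dots> \<le> ennreal (exp (- real k * \<delta>\<^sup>2)) + ennreal (exp (- real k))"
  proof (rule add_mono)
    show "(\<integral>\<^sup>+S. indicator ?dev S \<partial>P n) \<le> ennreal (exp (- real k * \<delta>\<^sup>2))"
      by (rule label_deviation_classifier_bound[OF smooth ball_measurable \<delta> margin x k])
    show "(\<integral>\<^sup>+S. indicator ?few S \<partial>P n) \<le> ennreal (exp (- real k))"
      using dim x pos(3) by (intro few_points_bound[OF ball_measurable _ mass]) (auto simp: intrinsic_dimension_def)
  qed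
  also have "\<dots> = ennreal (exp (- real k * \<delta>\<^sup>2) + exp (- real k))"
    by (rule ennreal_plus[symmetric]) auto
  also have "\<dots> \<le> ennreal (2 * exp (- real k * \<delta>\<^sup>2))"
  proof (rule ennreal_leI)
    have "\<delta>\<^sup>2 \<le> 1" using \<delta> power_mono[of \<delta> 1 2] by simp
    then have "real k * \<delta>\<^sup>2 \<le> real k" by (simp add: mult_left_le)
    then show "exp (- real k * \<delta>\<^sup>2) + exp (- real k) \<le> 2 * exp (- real k * \<delta>\<^sup>2)" by simp
  qed
  finally show ?thesis .
qed

section \<open>From disagreement to the expected excess error\<close>

text \<open>Where \<open>h\<close> errs and the Bayes classifier does not, the two disagree; such a
  point lies either in the margin region or outside it.\<close>

lemma error_le_bayes_plus_disagreement:
  assumes h [measurable]: "(\<lambda>z. h (fst z)) \<in> measurable D (count_space UNIV)"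
  shows "er D h \<le> er D (bayes_classifier \<eta>) + \<P>(z in D. \<bar>1/2 - \<eta> (fst z)\<bar> \<le> t)
    + \<P>(z in D. \<not> \<bar>1/2 - \<eta> (fst z)\<bar> \<le> t \<and> h (fst z) \<noteq> bayes_classifier \<eta> (fst z))"
proof -
  let ?A = "{z \<in> space D. bayes_classifier \<eta> (fst z) \<noteq> snd z}"
  let ?B = "{z \<in> space D. \<bar>1/2 - \<eta> (fst z)\<bar> \<le> t}"
  let ?C = "{z \<in> space D. \<not> \<bar>1/2 - \<eta> (fst z)\<bar> \<le> t \<and> h (fst z) \<noteq> bayes_classifier \<eta> (fst z)}"
  have A: "?A \<in> sets D" and B: "?B \<in> sets D" and C: "?C \<in> sets D" by measurable
  have "er D h \<le> prob (?A \<union> ?B \<union> ?C)"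
    unfolding er_def using A B C by (intro finite_measure_mono) auto
  also have "\<dots> \<le> prob (?A \<union> ?B) + prob ?C"
    using A B C by (intro measure_Un_le) auto
  also have "\<dots> \<le> prob ?A + prob ?B + prob ?C"
    using A B measure_Un_le[of ?A D ?B] by simp
  finally show ?thesis by (simp add: er_def)
qed

text \<open>Averaging over the sample first, for a fixed test point, reduces the disagreement
  outside the margin region to the pointwise bound with \<open>\<delta> = t / 2\<close>.\<close>

lemma excess_error_bound:
  assumes hs: "hoelder_smooth \<X> \<eta> lam ups" and pos: "lam > 0" "ups > 0" "r > 0"
    and t: "0 \<le> t" "t \<le> 1" and r: "lam * r powr ups \<le> t / 2"
    and k: "k \<ge> 1" and mass: "real n * min (C\<^sub>d * r ^ d) 1 \<ge> 4 * real k"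
    and ties: "no_distance_ties D k n"
  shows "expected_excess_error D \<eta> k n
    \<le> \<P>(z in D. \<bar>1/2 - \<eta> (fst z)\<bar> \<le> t) + 2 * exp (- real k * (t / 2)\<^sup>2)"
proof -
  interpret P: prob_space "P n" by (rule prob_space_sample)
  interpret PD: pair_sigma_finite "P n" D ..
  let ?N = "\<lambda>S x. nearest_neighbors k n S x"
  let ?far = "\<lambda>z. \<not> \<bar>1/2 - \<eta> (fst z)\<bar> \<le> t"
  let ?wrong = "\<lambda>S z. knn_classifier k n S (fst z) \<noteq> bayes_classifier \<eta> (fst z)"
  let ?\<epsilon> = "2 * exp (- real k * (t / 2)\<^sup>2)"
  define F where "F S = \<P>(z in D. ?far z \<and> ?wrong S z)" for S
  have F_nonneg: "F S \<ge> 0" for S by (simp add: F_def)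
  define f :: "(nat \<Rightarrow> 'a \<times> nat) \<Rightarrow> 'a \<times> nat \<Rightarrow> ennreal" where "f S z = (if ?far z \<and> ?wrong S z then 1 else 0)" for S z
  have f [measurable]: "case_prod f \<in> borel_measurable (P n \<Otimes>\<^sub>M D)"
    unfolding f_def case_prod_beta by measurable
  have cls [measurable]: "(\<lambda>z. knn_classifier k n S (fst z)) \<in> measurable D (count_space UNIV)"
    if "S \<in> space (P n)" for S
    using measurable_compose[OF measurable_Pair1'[OF that] classifier_measurable2] by simp
  have F_eq: "ennreal (F S) = (\<integral>\<^sup>+z. f S z \<partial>D)" if [measurable]: "S \<in> space (P n)" for S
  proof -
    have A: "{z \<in> space D. ?far z \<and> ?wrong S z} \<in> sets D" by measurable
    have "(\<integral>\<^sup>+z. f S z \<partial>D) = (\<integral>\<^sup>+z. indicator {z \<in> space D. ?far z \<and> ?wrong S z} z \<partial>D)"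
      by (intro nn_integral_cong) (auto simp: f_def)
    then show ?thesis using A by (simp add: F_def emeasure_eq_measure)
  qed
  have F_meas: "F \<in> borel_measurable (P n)"
  proof -
    have "(\<lambda>S. enn2real (\<integral>\<^sup>+z. f S z \<partial>D)) \<in> borel_measurable (P n)" by measurable
    moreover have "enn2real (\<integral>\<^sup>+z. f S z \<partial>D) = F S" if "S \<in> space (P n)" for S
      unfolding F_eq[OF that, symmetric] by (simp add: F_def)
    ultimately show ?thesis by (simp cong: measurable_cong)
  qed
  have F_int: "integrable (P n) F"
    using F_meas by (intro P.integrable_const_bound[where B = 1]) (auto simp: F_def)
  \<comment> \<open>Ties are excluded for almost every pair of sample and test point. The pointwise
    bound fixes the test point, so the order of the two quantifiers is exchanged.\<close>
  have no_ties: "AE z in D. AE S in P n. card (?N S (fst z)) = k"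
  proof -
    have "AE S in P n. AE z in D. card (?N S (fst z)) = k"
      using PD.AE_pair[OF ties[unfolded no_distance_ties_def]] by simp
    then show ?thesis
      by (subst (asm) PD.AE_commute) measurable
  qed
  have "ennreal (\<integral>S. F S \<partial>P n) = (\<integral>\<^sup>+S. ennreal (F S) \<partial>P n)"
    using F_int by (intro nn_integral_eq_integral[symmetric]) (auto simp: F_nonneg)
  also have "\<dots> = (\<integral>\<^sup>+S. (\<integral>\<^sup>+z. f S z \<partial>D) \<partial>P n)"
    using F_eq by (rule nn_integral_cong)
  also have "\<dots> = (\<integral>\<^sup>+z. (\<integral>\<^sup>+S. f S z \<partial>P n) \<partial>D)"
    by (rule PD.Fubini'[OF f, symmetric])
  also have "\<dots> \<le> (\<integral>\<^sup>+z. ennreal ?\<epsilon> \<partial>D)"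
  proof (rule nn_integral_mono_AE)
    show "AE z in D. (\<integral>\<^sup>+S. f S z \<partial>P n) \<le> ennreal ?\<epsilon>"
      using no_ties
    proof (rule AE_mp, intro AE_I2 impI)
      fix z assume z: "z \<in> space D" and ae: "AE S in P n. card (?N S (fst z)) = k"
      show "(\<integral>\<^sup>+S. f S z \<partial>P n) \<le> ennreal ?\<epsilon>"
      proof (cases "?far z")
        case True
        have x: "fst z \<in> \<X>" using z by (auto simp: space_D)
        have "(\<integral>\<^sup>+S. f S z \<partial>P n)
            = (\<integral>\<^sup>+S. indicator {S. card (?N S (fst z)) = k \<and> ?wrong S z} S \<partial>P n)"
          using ae by (intro nn_integral_cong_AE) (auto simp: f_def True elim!: eventually_mono)
        also have "\<dots> \<le> ennreal ?\<epsilon>"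
          using t r k mass True by (intro pointwise_disagreement_bound[OF hs pos _ _ _ _ x]) auto
        finally show ?thesis .
      qed (simp add: f_def)
    qed
  qed
  finally have F_le: "(\<integral>S. F S \<partial>P n) \<le> ?\<epsilon>"
    by (simp add: emeasure_space_1 ennreal_le_iff)
  let ?M = "\<P>(z in D. \<bar>1/2 - \<eta> (fst z)\<bar> \<le> t)"
  have "(\<integral>S. er D (knn_classifier k n S) \<partial>P n)
      \<le> (\<integral>S. er D (bayes_classifier \<eta>) + ?M + F S \<partial>P n)"
  \<comment> \<open>The rule asks for integrability and nonnegativity of the majorant, which is a
    constant plus \<open>F\<close>.\<close>
  proof (rule integral_mono')
    show "integrable (P n) (\<lambda>S. er D (bayes_classifier \<eta>) + ?M + F S)"
      using F_int by simp
    show "er D (knn_classifier k n S) \<le> er D (bayes_classifier \<eta>) + ?M + F S" if "S \<in> space (P n)" for S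
      unfolding F_def by (rule error_le_bayes_plus_disagreement[OF cls[OF that]])
    show "0 \<le> er D (bayes_classifier \<eta>) + ?M + F S" for S
      by (simp add: er_def F_def)
  qed
  also have "\<dots> = er D (bayes_classifier \<eta>) + ?M + (\<integral>S. F S \<partial>P n)"
    using F_int by (simp add: P.prob_space)
  finally show ?thesis using F_le by (simp add: expected_excess_error_def)
qed

end

section \<open>Choice of the scales and constants\<close>

theorem theorem4p1:
  fixes lam ups C\<^sub>d C\<^sub>\<upsilon> :: real and d V :: nat
  assumes "lam > 0" and "ups > 0" and "C\<^sub>d > 0"
    and "C\<^sub>\<upsilon> = 2 + real d / ups"
  shows "\<exists>K>0. \<forall>c\<in>{0<..<K}. \<exists>C'>0.
    \<forall>(\<X> :: 'a::real_normed_vector set) D \<eta> \<alpha> \<beta> \<gamma> n k.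
      data_distribution \<X> D \<longrightarrow>
      intrinsic_dimension \<X> D d C\<^sub>d \<longrightarrow>
      vc_dim (ball_class \<X>) = enat V \<longrightarrow>
      posterior \<X> D \<eta> \<longrightarrow>
      hoelder_smooth \<X> \<eta> lam ups \<longrightarrow>
      \<alpha> > 0 \<longrightarrow> \<beta> > 0 \<longrightarrow> \<gamma> > 0 \<longrightarrow>
      boltzmann_margin D \<eta> \<alpha> \<beta> \<gamma> \<longrightarrow>
      1 \<le> k \<longrightarrow> k \<le> n \<longrightarrow>
      no_distance_ties D k n \<longrightarrow>
      c * real n powr ((\<beta> + 2) / (\<beta> + C\<^sub>\<upsilon>)) \<le> real k \<longrightarrow>
      real k \<le> K * real n powr ((\<beta> + 2) / (\<beta> + C\<^sub>\<upsilon>)) \<longrightarrow>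
      real n \<ge> (C' * ln (real n)) powr (1 + C\<^sub>\<upsilon> / \<beta>) \<longrightarrow>
      expected_excess_error D \<eta> k n
        \<le> (2 + \<alpha>) * exp (- min \<gamma> (1 / C') * real n powr (\<beta> / (\<beta> + C\<^sub>\<upsilon>)))"
proof -
  \<comment> \<open>Chosen so that, for the radius \<open>r\<close> below,
    \<open>n * (C\<^sub>d * r ^ d)\<close> is exactly \<open>\<kappa>\<close> times
    \<open>n powr ((\<beta> + 2) / (\<beta> + C\<^sub>\<upsilon>))\<close>.\<close>
  define \<kappa> where "\<kappa> = C\<^sub>d / (2 * lam) powr (real d / ups)"
  \<comment> \<open>The factor 1/4 yields the mass \<open>4 * k / n\<close> of the Chernoff bound;
    the minimum with 1/4 serves the cap 1 in the dimension condition.\<close>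
  define K where "K = min (1/4) (\<kappa> / 4)"
  have "\<kappa> > 0" using assms by (simp add: \<kappa>_def)
  then have "K > 0" by (simp add: K_def)
  \<comment> \<open>The constant is \<open>C' = 4 / c\<close>: the lower bound on \<open>k\<close>
    makes the label exponent \<open>k * (t / 2)\<^sup>2\<close> at least \<open>c / 4\<close> times
    the target power of \<open>n\<close>.\<close>
  have bound: "expected_excess_error D \<eta> k n
      \<le> (2 + \<alpha>) * exp (- min \<gamma> (1 / (4 / c)) * real n powr (\<beta> / (\<beta> + C\<^sub>\<upsilon>)))"
    if c: "c > 0" and dist: "data_distribution \<X> D" and dim: "intrinsic_dimension \<X> D d C\<^sub>d"
      and post: "posterior \<X> D \<eta>" and hs: "hoelder_smooth \<X> \<eta> lam ups"
      and pos: "\<alpha> > 0" "\<beta> > 0" "\<gamma> > 0" and margin: "boltzmann_margin D \<eta> \<alpha> \<beta> \<gamma>"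
      and kn: "1 \<le> k" "k \<le> n" and ties: "no_distance_ties D k n"
      and lower: "c * real n powr ((\<beta> + 2) / (\<beta> + C\<^sub>\<upsilon>)) \<le> real k"
      and upper: "real k \<le> K * real n powr ((\<beta> + 2) / (\<beta> + C\<^sub>\<upsilon>))"
    for c \<alpha> \<beta> \<gamma> :: real and \<X> :: "'a set" and D \<eta> n k
  proof -
    interpret prob_space D using dist by (simp add: data_distribution_def)
    interpret data_model D \<X> \<eta> d C\<^sub>d
      by standard (use assms dist dim post in auto)
    have n: "real n \<ge> 1" using kn by simp
    have "C\<^sub>\<upsilon> \<ge> 2" using assms by simp
    then have s: "\<beta> + C\<^sub>\<upsilon> > 0" using pos by simp
    define t where "t = real n powr (- 1 / (\<beta> + C\<^sub>\<upsilon>))"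
    define r where "r = (t / (2 * lam)) powr (1 / ups)"
    let ?E = "real n powr (\<beta> / (\<beta> + C\<^sub>\<upsilon>))" and ?L = "real n powr ((\<beta> + 2) / (\<beta> + C\<^sub>\<upsilon>))"
    have t: "0 < t" "t \<le> 1"
      using n s powr_mono[of "- 1 / (\<beta> + C\<^sub>\<upsilon>)" 0 "real n"] by (auto simp: t_def divide_nonpos_pos)
    have r: "r > 0" using t assms by (simp add: r_def)
    have hr: "lam * r powr ups = t / 2"
      using t assms by (simp add: r_def powr_powr)
    have "r ^ d = (t / (2 * lam)) powr (real d / ups)"
      using r by (simp add: r_def powr_realpow[symmetric] powr_powr)
    also have "\<dots> = t powr (real d / ups) / (2 * lam) powr (real d / ups)"
      using t assms by (simp add: powr_divide)
    finally have "real n * (C\<^sub>d * r ^ d) = \<kappa> * (real n powr 1 * t powr (real d / ups))"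
      using n by (simp add: \<kappa>_def)
    also have "real n powr 1 * t powr (real d / ups) = real n powr (1 + (- 1 / (\<beta> + C\<^sub>\<upsilon>)) * (real d / ups))"
      by (simp only: t_def powr_powr powr_add)
    \<comment> \<open>Here the form of \<open>C\<^sub>\<upsilon>\<close> enters:
      \<open>d / ups = C\<^sub>\<upsilon> - 2\<close> gives the expected number of points in the
      ball the same power of \<open>n\<close> as \<open>k\<close>.\<close>
    also have "1 + (- 1 / (\<beta> + C\<^sub>\<upsilon>)) * (real d / ups) = (\<beta> + 2) / (\<beta> + C\<^sub>\<upsilon>)"
    proof -
      have "real d / ups = C\<^sub>\<upsilon> - 2" using assms by simp
      then show ?thesis unfolding \<open>real d / ups = _\<close> using s by (simp add: divide_simps)
    qed
    finally have m1: "real n * (C\<^sub>d * r ^ d) = \<kappa> * ?L" .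
    \<comment> \<open>As \<open>C\<^sub>\<upsilon>\<close> is at least 2, the exponent is at most 1;
      this handles the case in which the lower mass bound is capped at 1.\<close>
    have "?L \<le> real n powr 1"
      using n s assms by (intro powr_mono) (simp_all add: divide_le_eq)
    then have Ln: "?L \<le> real n" using n by simp
    have "4 * real k \<le> min \<kappa> 1 * ?L"
      using upper by (simp add: K_def min_mult_distrib_right split: if_splits)
    also have "\<dots> \<le> real n * min (C\<^sub>d * r ^ d) 1"
    proof -
      have "min \<kappa> 1 * ?L \<le> \<kappa> * ?L" "min \<kappa> 1 * ?L \<le> 1 * ?L"
        by (intro mult_right_mono; simp)+
      then show ?thesis using m1 Ln by (simp add: min_def)
    qed
    finally have mass: "real n * min (C\<^sub>d * r ^ d) 1 \<ge> 4 * real k" .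
    have "\<P>(z in D. \<bar>1/2 - \<eta> (fst z)\<bar> \<le> t) \<le> \<alpha> * exp (- \<gamma> * t powr (- \<beta>))"
      using margin t by (simp add: boltzmann_margin_def)
    also have "t powr (- \<beta>) = ?E" by (simp add: t_def powr_powr)
    finally have m2: "\<P>(z in D. \<bar>1/2 - \<eta> (fst z)\<bar> \<le> t) \<le> \<alpha> * exp (- \<gamma> * ?E)" .
    have "?L * t\<^sup>2 = ?L * t powr 2" using t by (simp add: powr_numeral)
    also have "\<dots> = real n powr ((\<beta> + 2) / (\<beta> + C\<^sub>\<upsilon>) + (- 1 / (\<beta> + C\<^sub>\<upsilon>)) * 2)"
      by (simp only: t_def powr_powr powr_add)
    also have "(\<beta> + 2) / (\<beta> + C\<^sub>\<upsilon>) + (- 1 / (\<beta> + C\<^sub>\<upsilon>)) * 2 = \<beta> / (\<beta> + C\<^sub>\<upsilon>)"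
      by (simp add: add_divide_distrib)
    finally have Lt: "?L * t\<^sup>2 = ?E" .
    have "c * ?L * t\<^sup>2 \<le> real k * t\<^sup>2" using lower by (intro mult_right_mono) auto
    then have kt: "c / 4 * ?E \<le> real k * (t / 2)\<^sup>2"
      unfolding Lt[symmetric] by (simp add: power_divide mult_ac)
    let ?g = "min \<gamma> (c / 4)"
    have g: "?g * ?E \<le> \<gamma> * ?E" "?g * ?E \<le> c / 4 * ?E"
      by (intro mult_right_mono; simp)+
    have "expected_excess_error D \<eta> k n
        \<le> \<P>(z in D. \<bar>1/2 - \<eta> (fst z)\<bar> \<le> t) + 2 * exp (- real k * (t / 2)\<^sup>2)"
      using t hr by (intro excess_error_bound[OF hs assms(1,2) r _ _ _ kn(1) mass ties]) auto
    \<comment> \<open>Both exponents are weakened to the common rate \<open>?g\<close>;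
      \<open>\<alpha>\<close> comes from the margin region and 2 from the sampling bound, giving the
      prefactor \<open>2 + \<alpha>\<close>.\<close>
    also have "\<dots> \<le> \<alpha> * exp (- ?g * ?E) + 2 * exp (- ?g * ?E)"
    proof (rule add_mono)
      have "\<alpha> * exp (- \<gamma> * ?E) \<le> \<alpha> * exp (- ?g * ?E)"
        using pos g(1) by (intro mult_left_mono) auto
      then show "\<P>(z in D. \<bar>1/2 - \<eta> (fst z)\<bar> \<le> t) \<le> \<alpha> * exp (- ?g * ?E)"
        using m2 by simp
      show "2 * exp (- real k * (t / 2)\<^sup>2) \<le> 2 * exp (- ?g * ?E)"
        using g(2) kt by simp
    qed
    also have "\<dots> = (2 + \<alpha>) * exp (- min \<gamma> (1 / (4 / c)) * ?E)"
      by (simp add: distrib_right)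
    finally show ?thesis .
  qed
  show ?thesis
    apply (rule exI[of _ K], intro conjI ballI)
     apply fact
    subgoal for c
      by (rule exI[of _ "4 / c"], intro conjI allI impI, simp, rule bound) (assumption | simp)+
    done
qed

end
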